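(* Let $X,Y$ be Polish metric spaces, $\mu$ a Borel probability measure on $X$, $\nu$ a Borel probability measure on $Y$, and $Z_m=\{z_1,\dots,z_m\}$ a finite set of $m$ points. Let $c^{(1)}:X\times Z_m\to\mathbb{R}$ and $c^{(2)}:Z_m\times Y\to\mathbb{R}$ be such that, for every $z\in Z_m$, $c^{(1)}(\cdot,z)$ is Borel and $\mu$-integrable and $c^{(2)}(z,\cdot)$ is Borel and $\nu$-integrable. Then $$\sup_{\vec p\in\mathbb{R}^m}\Xi^{\nu}_{\mu,Z_m}(\vec p)=c^{Z_m}(\mu,\nu).$$
   Context: The semi-discrete cost is $c^{Z_m}(x,y):=\min_{z\in Z_m}\left[c^{(1)}(x,z)+c^{(2)}(z,y)\right]$ for $(x,y)\in X\times Y$. Its optimal transport value is $c^{Z_m}(\mu,\nu):=\min_{\pi\in\Pi_X^Y(\mu,\nu)}\int_{X\times Y}c^{Z_m}(x,y)\,\pi(dx\,dy)$, where $\Pi_X^Y(\mu,\nu)$ is the set of Borel probability measures on $X\times Y$ whose $X$-marginal is $\mu$ and whose $Y$-marginal is $\nu$. Vectors $\vec p=(p_z)_{z\in Z_m}\in\mathbb{R}^m$ are indexed by $Z_m$. Define $$\xi^{(1)}_{Z_m}(\vec p,x):=\min_{z\in Z_m}\left[c^{(1)}(x,z)+p_z\right],\qquad \xi^{(2)}_{Z_m}(\vec p,y):=\min_{z\in Z_m}\left[c^{(2)}(z,y)+p_z\right],$$ $$\Xi_\mu^{Z_m}(\vec p):=\int_X\xi^{(1)}_{Z_m}(\vec p,x)\,\mu(dx),\qquad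 \Xi_\nu^{Z_m}(\vec p):=\int_Y\xi^{(2)}_{Z_m}(\vec p,y)\,\nu(dy),$$ $$\Xi^{\nu}_{\mu,Z_m}(\vec p):=\Xi_\mu^{Z_m}(\vec p)+\Xi_\nu^{Z_m}(-\vec p).$$ *)

theory Defs
  imports "HOL-Probability.Probability"
begin

definition semidiscrete_cost ::
  "'z set \<Rightarrow> ('a \<Rightarrow> 'z \<Rightarrow> real) \<Rightarrow> ('z \<Rightarrow> 'b \<Rightarrow> real) \<Rightarrow> 'a \<times> 'b \<Rightarrow> real" where
  "semidiscrete_cost Z c1 c2 = (\<lambda>(x, y). MIN z\<in>Z. c1 x z + c2 z y)"

definition couplings ::
  "'a::polish_space measure \<Rightarrow> 'b::polish_space measure \<Rightarrow> ('a \<times> 'b) measure set" where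
  "couplings \<mu> \<nu> = {\<pi>. prob_space \<pi> \<and> sets \<pi> = sets borel \<and>
     distr \<pi> borel fst = \<mu> \<and> distr \<pi> borel snd = \<nu>}"

(* The infimum is a real one. It is the minimum of the transport problem exactly when a minimiser
   exists (see is_optimal_coupling); otherwise it need not be meaningful. *)
definition transport_value ::
  "('a::polish_space \<times> 'b::polish_space \<Rightarrow> real) \<Rightarrow> 'a measure \<Rightarrow> 'b measure \<Rightarrow> real" where
  "transport_value c \<mu> \<nu> = (INF \<pi>\<in>couplings \<mu> \<nu>. \<integral>w. c w \<partial>\<pi>)"

definition is_optimal_coupling ::
  "('a::polish_space \<times> 'b::polish_space \<Rightarrow> real) \<Rightarrow> 'a measure \<Rightarrow> 'b measure
    \<Rightarrow> ('a \<times> 'b) measure \<Rightarrow> bool" where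
  "is_optimal_coupling c \<mu> \<nu> \<pi> \<longleftrightarrow>
     is_arg_min (\<lambda>\<pi>. \<integral>w. c w \<partial>\<pi>) (\<lambda>\<pi>. \<pi> \<in> couplings \<mu> \<nu>) \<pi>"

definition xi1 :: "'z set \<Rightarrow> ('a \<Rightarrow> 'z \<Rightarrow> real) \<Rightarrow> ('z \<Rightarrow> real) \<Rightarrow> 'a \<Rightarrow> real" where
  "xi1 Z c1 p x = (MIN z\<in>Z. c1 x z + p z)"

definition xi2 :: "'z set \<Rightarrow> ('z \<Rightarrow> 'b \<Rightarrow> real) \<Rightarrow> ('z \<Rightarrow> real) \<Rightarrow> 'b \<Rightarrow> real" where
  "xi2 Z c2 p y = (MIN z\<in>Z. c2 z y + p z)"

definition Xi1 :: "'z set \<Rightarrow> ('a \<Rightarrow> 'z \<Rightarrow> real) \<Rightarrow> 'a measure \<Rightarrow> ('z \<Rightarrow> real) \<Rightarrow> real" where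
  "Xi1 Z c1 \<mu> p = (\<integral>x. xi1 Z c1 p x \<partial>\<mu>)"

definition Xi2 :: "'z set \<Rightarrow> ('z \<Rightarrow> 'b \<Rightarrow> real) \<Rightarrow> 'b measure \<Rightarrow> ('z \<Rightarrow> real) \<Rightarrow> real" where
  "Xi2 Z c2 \<nu> p = (\<integral>y. xi2 Z c2 p y \<partial>\<nu>)"

definition Xi ::
  "'z set \<Rightarrow> ('a \<Rightarrow> 'z \<Rightarrow> real) \<Rightarrow> ('z \<Rightarrow> 'b \<Rightarrow> real) \<Rightarrow> 'a measure \<Rightarrow> 'b measure
    \<Rightarrow> ('z \<Rightarrow> real) \<Rightarrow> real" where
  "Xi Z c1 c2 \<mu> \<nu> p = Xi1 Z c1 \<mu> p + Xi2 Z c2 \<nu> (\<lambda>z\<in>Z. - p z)"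

end

theory Submission
  imports Defs
begin

text \<open>Weak duality holds since \<open>xi1 p x + xi2 (- p) y\<close> never exceeds the semi-discrete cost. For the
  converse, the concave dual functional attains its maximum at some \<open>p\<close>, being continuous, invariant
  under adding constants and coercive modulo constants. Its one-sided derivative at \<open>p\<close> in direction
  \<open>q\<close> is an integral of \<open>Min q\<close> over the sets of minimisers at \<open>x\<close> plus an integral of \<open>Min (- q)\<close> over
  those at \<open>y\<close>, so only the distribution of the finitely many possible sets of minimisers matters.
  As no direction ascends, a separation argument in finite dimension distributes \<open>\<mu>\<close> and \<open>\<nu>\<close> over \<open>Z\<close>
  within the sets of minimisers such that every \<open>z\<close> receives the same mass from both sides. Gluing
  along \<open>z\<close> gives a coupling on whose support weak duality is an equality; it is optimal.\<close>

section \<open>Minima over a finite set\<close>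

definition minimizers :: "'z set \<Rightarrow> ('z \<Rightarrow> real) \<Rightarrow> 'z set" where
  "minimizers Z g = {z \<in> Z. g z = (MIN w\<in>Z. g w)}"

lemma minimizers_nonempty:
  assumes "finite Z" "Z \<noteq> {}"
  shows "minimizers Z g \<noteq> {}"
proof -
  have "(MIN w\<in>Z. g w) \<in> g ` Z" using assms by (intro Min_in) auto
  then show ?thesis unfolding minimizers_def by force
qed

lemma minimizers_subset: "minimizers Z g \<subseteq> Z"
  by (auto simp: minimizers_def)

lemma Min_image_add_const:
  fixes g :: "'z \<Rightarrow> real"
  assumes "finite Z" "Z \<noteq> {}"
  shows "(MIN z\<in>Z. g z + a) = (MIN z\<in>Z. g z) + a"
proof (rule Min_eqI)
  show "finite ((\<lambda>z. g z + a) ` Z)" using assms by simp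
  show "(MIN z\<in>Z. g z) + a \<le> y" if "y \<in> (\<lambda>z. g z + a) ` Z" for y
    using that assms by auto
  have "(MIN z\<in>Z. g z) \<in> g ` Z" using assms by (intro Min_in) auto
  then show "(MIN z\<in>Z. g z) + a \<in> (\<lambda>z. g z + a) ` Z" by auto
qed

text \<open>The minimum is 1-Lipschitz for the sup norm. By symmetry one inequality suffices, and it
  comes from evaluating \<open>u\<close> at a minimiser of \<open>v\<close>.\<close>

lemma Min_image_diff_le:
  fixes g h :: "'z \<Rightarrow> real"
  assumes "finite Z" "Z \<noteq> {}" and le: "\<And>z. z \<in> Z \<Longrightarrow> \<bar>g z - h z\<bar> \<le> e"
  shows "\<bar>(MIN z\<in>Z. g z) - (MIN z\<in>Z. h z)\<bar> \<le> e"
proof -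
  have "(MIN z\<in>Z. u z) \<le> (MIN z\<in>Z. v z) + e"
    if "\<And>z. z \<in> Z \<Longrightarrow> \<bar>u z - v z\<bar> \<le> e" for u v :: "'z \<Rightarrow> real"
  proof -
    have "(MIN z\<in>Z. v z) \<in> v ` Z" using assms by (intro Min_in) auto
    then obtain z where z: "z \<in> Z" "(MIN z\<in>Z. v z) = v z" by auto
    have "(MIN z\<in>Z. u z) \<le> u z" using assms z by (intro Min_le) auto
    with that[OF z(1)] z show ?thesis by linarith
  qed
  from this[of g h] this[of h g] le show ?thesis by (force simp: abs_le_iff)
qed

text \<open>Off the minimisers \<open>g\<close> exceeds its minimum by a strict gap, which outweighs
  a perturbation of order \<open>e\<close>; on them \<open>g\<close> is constant and only
  \<open>q\<close> decides. As \<open>Z\<close> is finite, the first-order expansion is exact for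
  small \<open>e > 0\<close>.\<close>

lemma eventually_Min_image_perturbation:
  fixes g q :: "'z \<Rightarrow> real"
  assumes "finite Z" "Z \<noteq> {}"
  shows "\<forall>\<^sub>F e in at_right 0.
    (MIN z\<in>Z. g z + e * q z) = (MIN z\<in>Z. g z) + e * (MIN z\<in>minimizers Z g. q z)"
proof -
  define G where "G = (MIN z\<in>Z. g z)"
  define S where "S = minimizers Z g"
  define m where "m = (MIN z\<in>S. q z)"
  have S: "finite S" "S \<noteq> {}" "S \<subseteq> Z"
    unfolding S_def
    using finite_subset[OF minimizers_subset assms(1)] minimizers_nonempty[OF assms] minimizers_subset
    by simp_all
  have gS: "g z = G" if "z \<in> S" for z using that by (simp add: S_def G_def minimizers_def)
  have pos: "\<forall>\<^sub>F e::real in at_right 0. e > 0" by (simp add: eventually_at_right_less)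
  have "\<forall>\<^sub>F e in at_right 0. G + e * m \<le> g z + e * q z" if z: "z \<in> Z" for z
  proof (cases "z \<in> S")
    case True
    then have "m \<le> q z" unfolding m_def using S by (intro Min_le) auto
    then show ?thesis using pos gS[OF True]
      by (auto elim!: eventually_mono intro: mult_left_mono)
  next
    case False
    have "G \<le> g z" unfolding G_def using assms z by (intro Min_le) auto
    moreover have "G \<noteq> g z" using False z by (auto simp: S_def G_def minimizers_def)
    ultimately have "G < g z" by simp
    \<comment> \<open>The limit as \<open>e\<close> tends to 0 is the gap
      \<open>g z - G > 0\<close>.\<close>
    moreover have "((\<lambda>e. (g z + e * q z) - (G + e * m)) \<longlongrightarrow> (g z + 0 * q z) - (G + 0 * m)) (at_right 0)"
      by (intro tendsto_intros)
    ultimately have "\<forall>\<^sub>F e in at_right 0. 0 < (g z + e * q z) - (G + e * m)"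
      by (intro order_tendstoD(1)) auto
    then show ?thesis by (auto elim!: eventually_mono)
  qed
  then have "\<forall>\<^sub>F e in at_right 0. \<forall>z\<in>Z. G + e * m \<le> g z + e * q z"
    using assms by (intro eventually_ball_finite) auto
  then show ?thesis
  proof (rule eventually_mono)
    fix e assume le: "\<forall>z\<in>Z. G + e * m \<le> g z + e * q z"
    have "m \<in> q ` S" unfolding m_def using S by (intro Min_in) auto
    then obtain z where z: "z \<in> S" "m = q z" by auto
    then have "G + e * m \<in> (\<lambda>z. g z + e * q z) ` Z" using gS S by force
    then have "(MIN z\<in>Z. g z + e * q z) = G + e * m" using le assms by (intro Min_eqI) auto
    then show "(MIN z\<in>Z. g z + e * q z) = (MIN z\<in>Z. g z) + e * (MIN z\<in>minimizers Z g. q z)"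
      by (simp add: G_def m_def S_def)
  qed
qed

section \<open>Allocations within finite sets\<close>

text \<open>\<open>t (S, \<cdot>)\<close> is a probability vector supported on \<open>S\<close>, for each nonempty \<open>S \<subseteq> Z\<close>; uncurrying makes
  the compactness of a product of intervals directly applicable.\<close>
definition selections :: "'z set \<Rightarrow> ('z set \<times> 'z \<Rightarrow> real) set" where
  "selections Z = (UNIV \<rightarrow>\<^sub>E {0..1}) \<inter> {t. \<forall>S z. z \<notin> S \<longrightarrow> t (S, z) = 0}
     \<inter> {t. \<forall>S. S \<subseteq> Z \<and> S \<noteq> {} \<longrightarrow> (\<Sum>z\<in>Z. t (S, z)) = 1}"

lemma selections_iff:
  "t \<in> selections Z \<longleftrightarrow> (\<forall>i. 0 \<le> t i \<and> t i \<le> 1) \<and> (\<forall>S z. z \<notin> S \<longrightarrow> t (S, z) = 0)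
     \<and> (\<forall>S. S \<subseteq> Z \<and> S \<noteq> {} \<longrightarrow> (\<Sum>z\<in>Z. t (S, z)) = 1)"
  by (simp only: selections_def Int_iff mem_Collect_eq PiE_UNIV_domain Pi_iff UNIV_I
      atLeastAtMost_iff simp_thms Ball_def conj_assoc)

lemma compact_selections:
  fixes Z :: "'z set"
  shows "compact (selections Z)"
proof -
  have "compact (UNIV \<rightarrow>\<^sub>E {0..1::real} :: ('z set \<times> 'z \<Rightarrow> real) set)"
    using compactin_PiE[of "\<lambda>_. euclidean" UNIV "\<lambda>_. {0..1::real}"]
    by (simp add: euclidean_product_topology)
  moreover have "closed {t :: 'z set \<times> 'z \<Rightarrow> real. \<forall>S z. z \<notin> S \<longrightarrow> t (S, z) = 0}"
  proof (intro closed_Collect_all)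
    show "closed {t :: 'z set \<times> 'z \<Rightarrow> real. z \<notin> S \<longrightarrow> t (S, z) = 0}" for S z
      by (cases "z \<in> S") (simp_all add: closed_Collect_eq)
  qed
  moreover have "closed {t :: 'z set \<times> 'z \<Rightarrow> real.
      \<forall>S. S \<subseteq> Z \<and> S \<noteq> {} \<longrightarrow> (\<Sum>z\<in>Z. t (S, z)) = 1}"
  proof (rule closed_Collect_all)
    show "closed {t :: 'z set \<times> 'z \<Rightarrow> real. S \<subseteq> Z \<and> S \<noteq> {} \<longrightarrow> (\<Sum>z\<in>Z. t (S, z)) = 1}" for S
      by (cases "S \<subseteq> Z"; cases "S = {}") (simp_all add: closed_Collect_eq continuous_on_sum)
  qed
  ultimately show ?thesis unfolding selections_def
    by (intro compact_Int_closed)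
qed

lemma selections_convex_combination:
  assumes "t \<in> selections Z" "u \<in> selections Z" "0 \<le> l" "l \<le> 1"
  shows "(\<lambda>i. (1 - l) * t i + l * u i) \<in> selections Z"
proof -
  have t: "0 \<le> t i" "t i \<le> 1" "z \<notin> S \<Longrightarrow> t (S, z) = 0"
    "S \<subseteq> Z \<Longrightarrow> S \<noteq> {} \<Longrightarrow> (\<Sum>z\<in>Z. t (S, z)) = 1" for i z S
    using assms(1) unfolding selections_iff by blast+
  have u: "0 \<le> u i" "u i \<le> 1" "z \<notin> S \<Longrightarrow> u (S, z) = 0"
    "S \<subseteq> Z \<Longrightarrow> S \<noteq> {} \<Longrightarrow> (\<Sum>z\<in>Z. u (S, z)) = 1" for i z S
    using assms(2) unfolding selections_iff by blast+
  show ?thesis unfolding selections_iff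
  proof (intro conjI allI impI)
    show "0 \<le> (1 - l) * t i + l * u i" for i using t(1) u(1) assms by simp
    show "(1 - l) * t i + l * u i \<le> 1" for i
      using t u assms by (intro convex_bound_le) auto
    show "(1 - l) * t (S, z) + l * u (S, z) = 0" if "z \<notin> S" for S z
      using t(3)[OF that] u(3)[OF that] by simp
    show "(\<Sum>z\<in>Z. (1 - l) * t (S, z) + l * u (S, z)) = 1" if "S \<subseteq> Z \<and> S \<noteq> {}" for S
      using t(4)[of S] u(4)[of S] that by (simp add: sum.distrib flip: sum_distrib_left)
  qed
qed

lemma selection_of_function_in_selections:
  assumes "finite Z" and "\<And>S. S \<subseteq> Z \<Longrightarrow> S \<noteq> {} \<Longrightarrow> h S \<in> S"
  shows "(\<lambda>(S, z). if S \<subseteq> Z \<and> S \<noteq> {} \<and> z = h S then 1 else 0) \<in> selections Z"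
  unfolding selections_iff
proof (intro conjI allI impI)
  show "(\<Sum>z\<in>Z. case (S, z) of (S, z) \<Rightarrow> if S \<subseteq> Z \<and> S \<noteq> {} \<and> z = h S then 1 else (0::real)) = 1"
    if "S \<subseteq> Z \<and> S \<noteq> {}" for S
    using that assms(1) assms(2)[of S] by (auto simp: sum.delta)
qed (use assms(2) in \<open>auto split: prod.splits\<close>)

text \<open>The mass reaching \<open>z\<close> when every set \<open>S\<close> carries mass
  \<open>w S\<close> and \<open>t\<close> splits it among the points of \<open>S\<close>. The empty
  set is left out because a set of minimisers is never empty.\<close>

definition allocation :: "'z set \<Rightarrow> ('z set \<Rightarrow> real) \<Rightarrow> ('z set \<times> 'z \<Rightarrow> real) \<Rightarrow> 'z \<Rightarrow> real" where
  "allocation Z w t z = (\<Sum>S\<in>Pow Z - {{}}. w S * t (S, z))"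

lemma allocation_convex_combination:
  "allocation Z w (\<lambda>i. (1 - l) * t i + l * u i) z
    = (1 - l) * allocation Z w t z + l * allocation Z w u z"
  by (simp add: allocation_def sum_distrib_left algebra_simps flip: sum.distrib)

lemma continuous_on_allocation [continuous_intros]:
  assumes "continuous_on A F"
  shows "continuous_on A (\<lambda>x. allocation Z w (F x) z)"
proof -
  have "continuous_on A (\<lambda>x. F x i)" for i
    using continuous_on_compose2[OF continuous_on_product_coordinates assms] by simp
  then show ?thesis unfolding allocation_def by (intro continuous_intros)
qed

text \<open>All mass of \<open>S\<close> is sent to one minimiser \<open>h S\<close> of
  \<open>q\<close> on \<open>S\<close>. The choice depends on \<open>q\<close> alone, so one
  \<open>t\<close> serves every \<open>w\<close>. For nonnegative \<open>w\<close> the value is the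
  least one that the linear functional \<open>q\<close> takes on allocations.\<close>

lemma exists_selection_attaining_Min:
  fixes q :: "'z \<Rightarrow> real"
  assumes "finite Z"
  shows "\<exists>t\<in>selections Z. \<forall>w. (\<Sum>z\<in>Z. q z * allocation Z w t z)
    = (\<Sum>S\<in>Pow Z - {{}}. w S * (MIN z\<in>S. q z))"
proof -
  define h where "h S = (SOME z. z \<in> S \<and> q z = (MIN z\<in>S. q z))" for S
  define t :: "'z set \<times> 'z \<Rightarrow> real"
    where "t = (\<lambda>(S, z). if S \<subseteq> Z \<and> S \<noteq> {} \<and> z = h S then 1 else 0)"
  have h: "h S \<in> S \<and> q (h S) = (MIN z\<in>S. q z)" if "S \<subseteq> Z" "S \<noteq> {}" for S
  proof -
    have "finite S" using that assms finite_subset by blast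
    then have "(MIN z\<in>S. q z) \<in> q ` S" using that by (intro Min_in) auto
    then obtain z where "z \<in> S \<and> q z = (MIN z\<in>S. q z)" by auto
    then show ?thesis unfolding h_def by (rule someI)
  qed
  have t: "t \<in> selections Z" unfolding t_def
    using h assms by (intro selection_of_function_in_selections) blast+
  have "(\<Sum>z\<in>Z. q z * allocation Z w t z) = (\<Sum>S\<in>Pow Z - {{}}. w S * (MIN z\<in>S. q z))" for w
  proof -
    have "(\<Sum>z\<in>Z. q z * allocation Z w t z)
        = (\<Sum>S\<in>Pow Z - {{}}. \<Sum>z\<in>Z. q z * (w S * t (S, z)))"
      unfolding allocation_def sum_distrib_left by (rule sum.swap)
    also have "\<dots> = (\<Sum>S\<in>Pow Z - {{}}. w S * (MIN z\<in>S. q z))"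
    proof (rule sum.cong[OF refl])
      fix S assume "S \<in> Pow Z - {{}}"
      then have S: "S \<subseteq> Z" "S \<noteq> {}" by auto
      have "(\<Sum>z\<in>Z. q z * (w S * t (S, z))) = (\<Sum>z\<in>Z. if z = h S then q z * w S else 0)"
        using S by (intro sum.cong) (auto simp: t_def)
      also have "\<dots> = q (h S) * w S" using h[OF S] S assms by (auto simp: sum.delta)
      finally show "(\<Sum>z\<in>Z. q z * (w S * t (S, z))) = w S * (MIN z\<in>S. q z)"
        using h[OF S] by simp
    qed
    finally show ?thesis .
  qed
  then show ?thesis using t by blast
qed

text \<open>The first-order condition at a minimum along a segment: divide by \<open>l\<close> and
  let \<open>l\<close> tend to 0 from above.\<close>

lemma nonneg_of_quadratic_nonneg:
  fixes u v :: real
  assumes "\<And>l. 0 < l \<Longrightarrow> l \<le> 1 \<Longrightarrow> 0 \<le> l * u + l\<^sup>2 * v"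
  shows "0 \<le> u"
proof -
  have "((\<lambda>l. u + l * v) \<longlongrightarrow> u + 0 * v) (at_right 0)" by (intro tendsto_intros)
  moreover have "\<forall>\<^sub>F l in at_right 0. 0 \<le> u + l * v"
  proof -
    have "\<forall>\<^sub>F l::real in at_right 0. l \<in> {0<..<1}" by (rule eventually_at_right_real) simp
    then show ?thesis
    proof (rule eventually_mono)
      fix l :: real assume l: "l \<in> {0<..<1}"
      then have "0 \<le> l * (u + l * v)" using assms[of l] by (simp add: power2_eq_square algebra_simps)
      then show "0 \<le> u + l * v" using l by (simp add: zero_le_mult_iff)
    qed
  qed
  ultimately show ?thesis by (auto dest: tendsto_lowerbound)
qed

text \<open>The vector \<open>q\<close> of the second alternative is the difference of a closest pair of points of
  the two compact convex sets of allocations.\<close>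
lemma equal_allocations_or_separation:
  fixes w v :: "'z set \<Rightarrow> real"
  assumes "finite Z"
  obtains (equal) t s where "t \<in> selections Z" "s \<in> selections Z"
      "\<And>z. z \<in> Z \<Longrightarrow> allocation Z w t z = allocation Z v s z"
    | (separated) q where "0 < (\<Sum>S\<in>Pow Z - {{}}. w S * (MIN z\<in>S. q z))
        + (\<Sum>S\<in>Pow Z - {{}}. v S * (MIN z\<in>S. - q z))"
proof -
  \<comment> \<open>Squared Euclidean distance between the two allocations.\<close>
  define D where "D = (\<lambda>(t, s). \<Sum>z\<in>Z. (allocation Z w t z - allocation Z v s z)\<^sup>2)"
  have "selections Z \<noteq> {}" using exists_selection_attaining_Min[OF assms] by blast
  moreover have "continuous_on (selections Z \<times> selections Z) D"
    unfolding D_def case_prod_beta by (intro continuous_intros)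
  ultimately have "\<exists>x\<in>selections Z \<times> selections Z. \<forall>y\<in>selections Z \<times> selections Z. D x \<le> D y"
    by (intro continuous_attains_inf compact_Times compact_selections) auto
  then obtain t s where ts: "t \<in> selections Z" "s \<in> selections Z"
    and min: "\<And>t' s'. t' \<in> selections Z \<Longrightarrow> s' \<in> selections Z \<Longrightarrow> D (t, s) \<le> D (t', s')"
    by auto
  define q where "q z = allocation Z w t z - allocation Z v s z" for z
  show ?thesis
  proof (cases "\<forall>z\<in>Z. q z = 0")
    case True
    then show ?thesis using ts equal by (auto simp: q_def)
  next
    case False
    \<comment> \<open>The pairings of the new allocations with \<open>q\<close> and
      \<open>- q\<close> are the two sums of the separated case.\<close>
    obtain t' where t': "t' \<in> selections Z"
      "(\<Sum>z\<in>Z. q z * allocation Z w t' z) = (\<Sum>S\<in>Pow Z - {{}}. w S * (MIN z\<in>S. q z))"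
      using exists_selection_attaining_Min[OF assms] by blast
    obtain s' where s': "s' \<in> selections Z"
      "(\<Sum>z\<in>Z. - q z * allocation Z v s' z) = (\<Sum>S\<in>Pow Z - {{}}. v S * (MIN z\<in>S. - q z))"
      using exists_selection_attaining_Min[OF assms, of "\<lambda>z. - q z"] by blast
    define e where "e z = allocation Z w t' z - allocation Z v s' z" for z
    \<comment> \<open>Moving from the closest pair towards \<open>(t', s')\<close> cannot shorten
      the distance; the right-hand side is the change of \<open>D\<close> at step length
      \<open>l\<close>.\<close>
    have "0 \<le> l * (2 * (\<Sum>z\<in>Z. q z * (e z - q z))) + l\<^sup>2 * (\<Sum>z\<in>Z. (e z - q z)\<^sup>2)"
      if l: "0 < l" "l \<le> 1" for l
    proof -
      have "D (t, s) \<le> D (\<lambda>i. (1 - l) * t i + l * t' i, \<lambda>i. (1 - l) * s i + l * s' i)"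
        using l ts t' s' by (intro min selections_convex_combination) auto
      also have "\<dots> = (\<Sum>z\<in>Z. (q z + l * (e z - q z))\<^sup>2)"
        unfolding D_def allocation_convex_combination prod.case
        by (intro sum.cong refl arg_cong[where f = "\<lambda>x. x\<^sup>2"]) (simp add: q_def e_def algebra_simps)
      also have "\<dots> = (\<Sum>z\<in>Z. (q z)\<^sup>2 + (l * 2 * (q z * (e z - q z)) + l\<^sup>2 * (e z - q z)\<^sup>2))"
        by (intro sum.cong) (auto simp: power2_eq_square algebra_simps)
      also have "\<dots> = D (t, s) + (l * (2 * (\<Sum>z\<in>Z. q z * (e z - q z))) + l\<^sup>2 * (\<Sum>z\<in>Z. (e z - q z)\<^sup>2))"
        by (simp add: D_def q_def sum.distrib mult.assoc flip: sum_distrib_left)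
      finally show ?thesis by simp
    qed
    then have "0 \<le> 2 * (\<Sum>z\<in>Z. q z * (e z - q z))" by (rule nonneg_of_quadratic_nonneg)
    \<comment> \<open>Nonnegativity of the linear coefficient bounds the pairing of \<open>q\<close>
      with \<open>e\<close> below by the squared norm of \<open>q\<close>, which is
      positive.\<close>
    then have "(\<Sum>z\<in>Z. (q z)\<^sup>2) \<le> (\<Sum>z\<in>Z. q z * e z)"
      by (simp add: algebra_simps power2_eq_square sum_subtractf)
    moreover have "0 < (\<Sum>z\<in>Z. (q z)\<^sup>2)"
    proof -
      from False obtain z where "z \<in> Z" "q z \<noteq> 0" by blast
      then show ?thesis using assms by (intro sum_pos2[of Z z]) auto
    qed
    moreover have "(\<Sum>z\<in>Z. q z * e z)
        = (\<Sum>z\<in>Z. q z * allocation Z w t' z) + (\<Sum>z\<in>Z. - q z * allocation Z v s' z)"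
      unfolding e_def by (simp add: algebra_simps sum_subtractf flip: sum.distrib)
    ultimately show ?thesis using t'(2) s'(2) by (intro separated[of q]) linarith
  qed
qed

section \<open>Gluing measures along a finite set\<close>

text \<open>By Tonelli, the marginal mass of a set is the integral over it of the inner integral of
  \<open>h\<close>, which is 1 almost everywhere.\<close>

lemma pair_measure_density_marginals:
  assumes "prob_space M" "prob_space N"
    and h[measurable]: "h \<in> borel_measurable (M \<Otimes>\<^sub>M N)"
    and fst: "AE x in M. (\<integral>\<^sup>+y. h (x, y) \<partial>N) = 1"
    and snd: "AE y in N. (\<integral>\<^sup>+x. h (x, y) \<partial>M) = 1"
  shows "distr (density (M \<Otimes>\<^sub>M N) h) M fst = M"
    and "distr (density (M \<Otimes>\<^sub>M N) h) N snd = N"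
proof -
  interpret M: prob_space M by fact
  interpret N: prob_space N by fact
  interpret pair_sigma_finite M N ..
  show "distr (density (M \<Otimes>\<^sub>M N) h) M fst = M"
  proof (rule measure_eqI)
    fix A assume "A \<in> sets (distr (density (M \<Otimes>\<^sub>M N) h) M fst)"
    then have [measurable]: "A \<in> sets M" by simp
    have "emeasure (distr (density (M \<Otimes>\<^sub>M N) h) M fst) A
        = (\<integral>\<^sup>+w. h w * indicator A (fst w) \<partial>(M \<Otimes>\<^sub>M N))"
      by (subst emeasure_distr, simp, simp, subst emeasure_density)
        (auto intro!: nn_integral_cong simp: indicator_def)
    also have "\<dots> = (\<integral>\<^sup>+x. \<integral>\<^sup>+y. h (x, y) * indicator A x \<partial>N \<partial>M)"
      by (subst N.nn_integral_fst[symmetric]) auto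
    also have "\<dots> = (\<integral>\<^sup>+x. (\<integral>\<^sup>+y. h (x, y) \<partial>N) * indicator A x \<partial>M)"
      by (intro nn_integral_cong nn_integral_multc) auto
    also have "\<dots> = (\<integral>\<^sup>+x. indicator A x \<partial>M)"
      using fst by (intro nn_integral_cong_AE) auto
    finally show "emeasure (distr (density (M \<Otimes>\<^sub>M N) h) M fst) A = emeasure M A" by simp
  qed simp
  show "distr (density (M \<Otimes>\<^sub>M N) h) N snd = N"
  proof (rule measure_eqI)
    fix A assume "A \<in> sets (distr (density (M \<Otimes>\<^sub>M N) h) N snd)"
    then have [measurable]: "A \<in> sets N" by simp
    have "emeasure (distr (density (M \<Otimes>\<^sub>M N) h) N snd) A
        = (\<integral>\<^sup>+w. h w * indicator A (snd w) \<partial>(M \<Otimes>\<^sub>M N))"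
      by (subst emeasure_distr, simp, simp, subst emeasure_density)
        (auto intro!: nn_integral_cong simp: indicator_def)
    also have "\<dots> = (\<integral>\<^sup>+y. \<integral>\<^sup>+x. h (x, y) * indicator A y \<partial>M \<partial>N)"
      by (subst nn_integral_snd[symmetric]) auto
    also have "\<dots> = (\<integral>\<^sup>+y. (\<integral>\<^sup>+x. h (x, y) \<partial>M) * indicator A y \<partial>N)"
      by (intro nn_integral_cong nn_integral_multc) auto
    also have "\<dots> = (\<integral>\<^sup>+y. indicator A y \<partial>N)"
      using snd by (intro nn_integral_cong_AE) auto
    finally show "emeasure (distr (density (M \<Otimes>\<^sub>M N) h) N snd) A = emeasure N A" by simp
  qed simp
qed

text \<open>Integrating out \<open>y\<close> cancels the mass in the denominator and leaves
  \<open>\<Sum>z\<in>Z. f z x\<close>, which is 1. Points \<open>z\<close> of mass 0 limit the claim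
  to almost every \<open>x\<close>.\<close>

lemma AE_nn_integral_glued_density:
  fixes f :: "'z \<Rightarrow> 'a \<Rightarrow> real" and g :: "'z \<Rightarrow> 'b \<Rightarrow> real"
  assumes "finite Z"
    and f: "\<And>z. z \<in> Z \<Longrightarrow> integrable M (f z)" "\<And>z x. 0 \<le> f z x"
    and g: "\<And>z. z \<in> Z \<Longrightarrow> integrable N (g z)" "\<And>z y. 0 \<le> g z y"
    and one: "\<And>x. x \<in> space M \<Longrightarrow> (\<Sum>z\<in>Z. f z x) = 1"
    and eq: "\<And>z. z \<in> Z \<Longrightarrow> (\<integral>x. f z x \<partial>M) = (\<integral>y. g z y \<partial>N)"
  shows "AE x in M. (\<integral>\<^sup>+y. ennreal (\<Sum>z\<in>Z. f z x * g z y / (\<integral>y. g z y \<partial>N)) \<partial>N) = 1"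
proof -
  \<comment> \<open>A point \<open>z\<close> of mass 0 on the \<open>N\<close> side has mass 0 on
    the \<open>M\<close> side too, hence \<open>f z\<close> vanishes almost everywhere.\<close>
  have "AE x in M. \<forall>z\<in>Z. (\<integral>y. g z y \<partial>N) = 0 \<longrightarrow> f z x = 0"
  proof (intro AE_finite_allI[OF assms(1)])
    fix z assume z: "z \<in> Z"
    show "AE x in M. (\<integral>y. g z y \<partial>N) = 0 \<longrightarrow> f z x = 0"
    proof (cases "(\<integral>y. g z y \<partial>N) = 0")
      case True
      then show ?thesis
        using integral_nonneg_eq_0_iff_AE[of M "f z"] f z eq[OF z] by auto
    qed simp
  qed
  then show ?thesis
  proof (rule AE_mp, intro AE_I2 impI)
    fix x assume x: "x \<in> space M" and null: "\<forall>z\<in>Z. (\<integral>y. g z y \<partial>N) = 0 \<longrightarrow> f z x = 0"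
    have "(\<integral>\<^sup>+y. ennreal (\<Sum>z\<in>Z. f z x * g z y / (\<integral>y. g z y \<partial>N)) \<partial>N)
        = ennreal (\<integral>y. (\<Sum>z\<in>Z. f z x * g z y / (\<integral>y. g z y \<partial>N)) \<partial>N)"
      using f g by (intro nn_integral_eq_integral)
        (auto intro!: sum_nonneg divide_nonneg_nonneg Bochner_Integration.integrable_sum
          integrable_divide integrable_mult_right)
    also have "(\<integral>y. (\<Sum>z\<in>Z. f z x * g z y / (\<integral>y. g z y \<partial>N)) \<partial>N)
        = (\<Sum>z\<in>Z. f z x * (\<integral>y. g z y \<partial>N) / (\<integral>y. g z y \<partial>N))"
      using g by (subst Bochner_Integration.integral_sum) auto
    \<comment> \<open>A positive mass cancels; for mass 0 the quotient is 0 by the convention on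
      division, and so is \<open>f z x\<close>.\<close>
    also have "\<dots> = (\<Sum>z\<in>Z. f z x)" using null by (intro sum.cong) auto
    also have "\<dots> = 1" by (rule one[OF x])
    finally show "(\<integral>\<^sup>+y. ennreal (\<Sum>z\<in>Z. f z x * g z y / (\<integral>y. g z y \<partial>N)) \<partial>N) = 1" by simp
  qed
qed

text \<open>Think of \<open>f z x\<close> and \<open>g z y\<close> as the probabilities that
  \<open>x\<close> and \<open>y\<close> are assigned to \<open>z\<close>. The coupling picks
  \<open>z\<close> with the common mass and then draws \<open>x\<close> and \<open>y\<close>
  independently given \<open>z\<close>; \<open>h\<close> is its density against the product
  measure.\<close>

lemma exists_glued_coupling:
  fixes f :: "'z \<Rightarrow> 'a \<Rightarrow> real" and g :: "'z \<Rightarrow> 'b \<Rightarrow> real"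
  assumes M: "prob_space M" and N: "prob_space N" and Z: "finite Z"
    and f: "\<And>z. z \<in> Z \<Longrightarrow> integrable M (f z)" "\<And>z x. 0 \<le> f z x"
    and g: "\<And>z. z \<in> Z \<Longrightarrow> integrable N (g z)" "\<And>z y. 0 \<le> g z y"
    and one: "\<And>x. x \<in> space M \<Longrightarrow> (\<Sum>z\<in>Z. f z x) = 1"
      "\<And>y. y \<in> space N \<Longrightarrow> (\<Sum>z\<in>Z. g z y) = 1"
    and eq: "\<And>z. z \<in> Z \<Longrightarrow> (\<integral>x. f z x \<partial>M) = (\<integral>y. g z y \<partial>N)"
  obtains \<pi> where "prob_space \<pi>" "sets \<pi> = sets (M \<Otimes>\<^sub>M N)"
    "distr \<pi> M fst = M" "distr \<pi> N snd = N"
    "AE w in \<pi>. \<exists>z\<in>Z. 0 < f z (fst w) \<and> 0 < g z (snd w)"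
proof -
  define h where "h w = (\<Sum>z\<in>Z. f z (fst w) * g z (snd w) / (\<integral>y. g z y \<partial>N))" for w
  define \<pi> where "\<pi> = density (M \<Otimes>\<^sub>M N) h"
  have [measurable]: "z \<in> Z \<Longrightarrow> f z \<in> borel_measurable M" "z \<in> Z \<Longrightarrow> g z \<in> borel_measurable N" for z
    using f g by auto
  have h: "h \<in> borel_measurable (M \<Otimes>\<^sub>M N)" unfolding h_def by measurable
  have 1: "AE x in M. (\<integral>\<^sup>+y. ennreal (h (x, y)) \<partial>N) = 1"
    using AE_nn_integral_glued_density[OF Z f g one(1) eq] by (simp add: h_def)
  \<comment> \<open>The same with the two sides exchanged; equal masses make this density coincide
    with \<open>h\<close>.\<close>
  have "AE y in N. (\<integral>\<^sup>+x. ennreal (\<Sum>z\<in>Z. g z y * f z x / (\<integral>x. f z x \<partial>M)) \<partial>M) = 1"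
    using AE_nn_integral_glued_density[OF Z g f one(2) eq[symmetric]] by simp
  moreover have "(\<Sum>z\<in>Z. g z y * f z x / (\<integral>x. f z x \<partial>M)) = h (x, y)" for x y
    unfolding h_def by (intro sum.cong) (auto simp: eq mult.commute)
  ultimately have 2: "AE y in N. (\<integral>\<^sup>+x. ennreal (h (x, y)) \<partial>M) = 1" by simp
  have marginals: "distr \<pi> M fst = M" "distr \<pi> N snd = N"
    using pair_measure_density_marginals[OF M N _ 1 2] h by (auto simp: \<pi>_def)
  show ?thesis
  proof
    show sets: "sets \<pi> = sets (M \<Otimes>\<^sub>M N)" by (simp add: \<pi>_def)
    show "prob_space \<pi>"
      using M marginals(1) by (intro prob_space_distrD[of fst \<pi> M]) (simp_all add: \<pi>_def)
    have "\<exists>z\<in>Z. 0 < f z (fst w) \<and> 0 < g z (snd w)" if "0 < h w" for w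
    proof (rule ccontr)
      assume "\<not> ?thesis"
      then have "f z (fst w) = 0 \<or> g z (snd w) = 0" if "z \<in> Z" for z
        using f(2) g(2) that by (metis less_le)
      then have "h w = 0" unfolding h_def by (intro sum.neutral) auto
      with \<open>0 < h w\<close> show False by simp
    qed
    \<comment> \<open>Under the measure with density \<open>h\<close>, almost every point satisfies
      \<open>h w > 0\<close>.\<close>
    then show "AE w in \<pi>. \<exists>z\<in>Z. 0 < f z (fst w) \<and> 0 < g z (snd w)"
      unfolding \<pi>_def using h by (subst AE_density) auto
  qed (fact marginals)+
qed

section \<open>The integrated minimum and its directional derivative\<close>

lemma xi1_eq_xi2: "xi1 Z c1 = xi2 Z (\<lambda>z x. c1 x z)"
  by (simp add: xi1_def xi2_def fun_eq_iff)

lemma Xi1_eq_Xi2: "Xi1 Z c1 = Xi2 Z (\<lambda>z x. c1 x z)"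
  by (simp add: Xi1_def Xi2_def xi1_eq_xi2 fun_eq_iff)

lemma xi2_cong: "(\<And>z. z \<in> Z \<Longrightarrow> p z = q z) \<Longrightarrow> xi2 Z f p y = xi2 Z f q y"
  unfolding xi2_def by (intro arg_cong[where f = Min] image_cong) auto

lemma Xi2_cong: "(\<And>z. z \<in> Z \<Longrightarrow> p z = q z) \<Longrightarrow> Xi2 Z f M p = Xi2 Z f M q"
  unfolding Xi2_def by (intro Bochner_Integration.integral_cong refl xi2_cong)

text \<open>One side of the problem. The second side is an instance directly and the first after
  swapping the arguments of its cost, so each estimate is proved once.\<close>

locale finite_cost = prob_space M for M :: "'a measure" +
  fixes Z :: "'z set" and f :: "'z \<Rightarrow> 'a \<Rightarrow> real"
  assumes finite_Z: "finite Z" and nonempty_Z: "Z \<noteq> {}"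
    and integrable_cost: "\<And>z. z \<in> Z \<Longrightarrow> integrable M (f z)"
begin

lemma measurable_cost [measurable]: "z \<in> Z \<Longrightarrow> f z \<in> borel_measurable M"
  using integrable_cost by auto

lemma xi2_le: "z \<in> Z \<Longrightarrow> xi2 Z f p x \<le> f z x + p z"
  unfolding xi2_def using finite_Z by (intro Min_le) auto

lemma measurable_xi2 [measurable]: "xi2 Z f p \<in> borel_measurable M"
  unfolding xi2_def using finite_Z by measurable

text \<open>The minimum equals one of its terms, hence is dominated by the sum of their absolute
  values.\<close>

lemma integrable_xi2: "integrable M (xi2 Z f p)"
proof (rule Bochner_Integration.integrable_bound)
  show "integrable M (\<lambda>x. \<Sum>z\<in>Z. \<bar>f z x + p z\<bar>)"
    using integrable_cost by (intro Bochner_Integration.integrable_sum integrable_abs) auto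
  have "\<bar>xi2 Z f p x\<bar> \<le> (\<Sum>z\<in>Z. \<bar>f z x + p z\<bar>)" for x
  proof -
    have "xi2 Z f p x \<in> (\<lambda>z. f z x + p z) ` Z"
      unfolding xi2_def using finite_Z nonempty_Z by (intro Min_in) auto
    then obtain z where z: "z \<in> Z" "xi2 Z f p x = f z x + p z" by auto
    then show ?thesis using finite_Z by (auto intro: member_le_sum[of z Z "\<lambda>z. \<bar>f z x + p z\<bar>"])
  qed
  then show "AE x in M. norm (xi2 Z f p x) \<le> norm (\<Sum>z\<in>Z. \<bar>f z x + p z\<bar>)"
    by (auto simp: sum_nonneg)
qed simp

lemma abs_xi2_diff_le:
  assumes "\<And>z. z \<in> Z \<Longrightarrow> \<bar>p z - q z\<bar> \<le> e"
  shows "\<bar>xi2 Z f p x - xi2 Z f q x\<bar> \<le> e"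
  unfolding xi2_def using assms finite_Z nonempty_Z by (intro Min_image_diff_le) auto

lemma abs_Xi2_diff_le:
  assumes "\<And>z. z \<in> Z \<Longrightarrow> \<bar>p z - q z\<bar> \<le> e"
  shows "\<bar>Xi2 Z f M p - Xi2 Z f M q\<bar> \<le> e"
proof -
  have "\<bar>Xi2 Z f M p - Xi2 Z f M q\<bar> = \<bar>\<integral>x. (xi2 Z f p x - xi2 Z f q x) \<partial>M\<bar>"
    by (simp add: Xi2_def integrable_xi2)
  also have "\<dots> \<le> (\<integral>x. \<bar>xi2 Z f p x - xi2 Z f q x\<bar> \<partial>M)" by (rule integral_abs_bound)
  also have "\<dots> \<le> e"
    using abs_xi2_diff_le[of p q e] assms
    by (intro integral_le_const integrable_abs Bochner_Integration.integrable_diff integrable_xi2) auto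
  finally show ?thesis .
qed

text \<open>The topology on potentials is that of pointwise convergence. For it the finite sum of
  the coordinate differences over \<open>Z\<close> is continuous, and this sum serves as the
  Lipschitz bound.\<close>

lemma continuous_on_Xi2: "continuous_on UNIV (Xi2 Z f M)"
  unfolding continuous_on_def
proof (intro ballI)
  fix p :: "'z \<Rightarrow> real"
  have "((\<lambda>q. \<Sum>z\<in>Z. \<bar>q z - p z\<bar>) \<longlongrightarrow> (\<Sum>z\<in>Z. \<bar>p z - p z\<bar>)) (at p)"
    using continuous_on_product_coordinates[where 'b = real and 'a = 'z]
    by (intro tendsto_intros) (auto simp: continuous_on_def)
  then have "((\<lambda>q. \<Sum>z\<in>Z. \<bar>q z - p z\<bar>) \<longlongrightarrow> 0) (at p)" by simp
  then have "((\<lambda>q. Xi2 Z f M q - Xi2 Z f M p) \<longlongrightarrow> 0) (at p)"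
  proof (rule Lim_null_comparison[rotated])
    have "\<bar>Xi2 Z f M q - Xi2 Z f M p\<bar> \<le> (\<Sum>z\<in>Z. \<bar>q z - p z\<bar>)" for q
      using finite_Z by (intro abs_Xi2_diff_le member_le_sum) auto
    then show "\<forall>\<^sub>F q in at p. norm (Xi2 Z f M q - Xi2 Z f M p) \<le> (\<Sum>z\<in>Z. \<bar>q z - p z\<bar>)"
      by simp
  qed
  then show "(Xi2 Z f M \<longlongrightarrow> Xi2 Z f M p) (at p within UNIV)" by (rule LIM_zero_cancel)
qed

lemma Xi2_add_const: "Xi2 Z f M (\<lambda>z. p z + a) = Xi2 Z f M p + a"
proof -
  have "xi2 Z f (\<lambda>z. p z + a) x = xi2 Z f p x + a" for x
    using Min_image_add_const[OF finite_Z nonempty_Z, of "\<lambda>z. f z x + p z" a]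
    by (simp add: xi2_def add.assoc)
  then show ?thesis by (simp add: Xi2_def integrable_xi2 prob_space)
qed

lemma Xi2_le: "z \<in> Z \<Longrightarrow> Xi2 Z f M p \<le> (\<integral>x. f z x \<partial>M) + p z"
proof -
  assume z: "z \<in> Z"
  have "Xi2 Z f M p \<le> (\<integral>x. f z x + p z \<partial>M)"
    unfolding Xi2_def using z xi2_le integrable_cost[OF z] integrable_xi2
    by (intro integral_mono) auto
  then show ?thesis using integrable_cost[OF z] by (simp add: prob_space)
qed

section \<open>Sets of minimisers and their distribution\<close>

definition argmin :: "('z \<Rightarrow> real) \<Rightarrow> 'a \<Rightarrow> 'z set" where
  "argmin p x = minimizers Z (\<lambda>z. f z x + p z)"

lemma argmin_subset: "argmin p x \<subseteq> Z"
  by (auto simp: argmin_def minimizers_def)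

lemma argmin_nonempty: "argmin p x \<noteq> {}"
  unfolding argmin_def by (rule minimizers_nonempty[OF finite_Z nonempty_Z])

lemma xi2_eq_of_mem_argmin: "z \<in> argmin p x \<Longrightarrow> xi2 Z f p x = f z x + p z"
  by (simp add: argmin_def minimizers_def xi2_def)

text \<open>For \<open>S \<subseteq> Z\<close> the event is a finite conjunction of comparisons of
  measurable functions; for other \<open>S\<close> it is empty.\<close>

lemma sets_argmin_eq: "{x \<in> space M. argmin p x = S} \<in> sets M"
proof (cases "S \<subseteq> Z")
  case True
  have "{x \<in> space M. \<forall>z\<in>Z. z \<in> S \<longleftrightarrow> f z x + p z = xi2 Z f p x} \<in> sets M"
    using finite_Z by measurable
  moreover have "argmin p x = S \<longleftrightarrow> (\<forall>z\<in>Z. z \<in> S \<longleftrightarrow> f z x + p z = xi2 Z f p x)" for x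
    using True by (auto simp: argmin_def minimizers_def xi2_def)
  ultimately show ?thesis by simp
next
  case False
  then have empty: "{x \<in> space M. argmin p x = S} = {}" using argmin_subset by blast
  show ?thesis unfolding empty by simp
qed

definition argmin_weight :: "('z \<Rightarrow> real) \<Rightarrow> 'z set \<Rightarrow> real" where
  "argmin_weight p S = prob {x \<in> space M. argmin p x = S}"

text \<open>\<open>argmin p\<close> takes only finitely many values, all of them nonempty subsets of
  \<open>Z\<close>, so any real function of it is a simple function.\<close>

lemma has_bochner_integral_argmin:
  fixes g :: "'z set \<Rightarrow> real"
  shows "has_bochner_integral M (\<lambda>x. g (argmin p x)) (\<Sum>S\<in>Pow Z - {{}}. argmin_weight p S * g S)"
proof -
  have "has_bochner_integral M
      (\<lambda>x. \<Sum>S\<in>Pow Z - {{}}. indicator {x \<in> space M. argmin p x = S} x * g S)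
      (\<Sum>S\<in>Pow Z - {{}}. argmin_weight p S * g S)"
    unfolding argmin_weight_def
    by (intro has_bochner_integral_sum has_bochner_integral_mult_left
        has_bochner_integral_real_indicator sets_argmin_eq emeasure_finite[THEN less_top[THEN iffD1]])
      (simp add: less_top[symmetric])
  moreover have "(\<Sum>S\<in>Pow Z - {{}}. indicator {x \<in> space M. argmin p x = S} x * g S) = g (argmin p x)"
    if "x \<in> space M" for x
  proof -
    have "(\<Sum>S\<in>Pow Z - {{}}. indicator {x \<in> space M. argmin p x = S} x * g S)
        = (\<Sum>S\<in>Pow Z - {{}}. if S = argmin p x then g S else 0)"
      using that by (intro sum.cong) (auto simp: indicator_def)
    also have "\<dots> = g (argmin p x)"
      using argmin_subset[of p x] argmin_nonempty[of p x] finite_Z by (simp add: sum.delta)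
    finally show ?thesis .
  qed
  ultimately show ?thesis by (subst has_bochner_integral_cong[OF refl _ refl]) auto
qed

text \<open>At each point the difference quotient is eventually constant, since the expansion of the
  minimum is exact for small steps. Dominated convergence applies along the sequence of steps
  because the quotients are uniformly bounded.\<close>

lemma Xi2_directional_derivative:
  "(\<lambda>n. (Xi2 Z f M (\<lambda>z. p z + inverse (real (Suc n)) * q z) - Xi2 Z f M p) / inverse (real (Suc n)))
    \<longlonglongrightarrow> (\<Sum>S\<in>Pow Z - {{}}. argmin_weight p S * (MIN z\<in>S. q z))"
proof -
  define e :: "nat \<Rightarrow> real" where "e n = inverse (real (Suc n))" for n
  have e_pos: "0 < e n" for n by (simp add: e_def)
  have "e \<longlonglongrightarrow> 0" unfolding e_def by (rule LIMSEQ_inverse_real_of_nat)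
  then have e: "filterlim e (at_right 0) sequentially"
    using e_pos by (intro tendsto_imp_filterlim_at_right) auto
  \<comment> \<open>The dominating constant: it bounds \<open>\<bar>q z\<bar>\<close> on
    \<open>Z\<close>, and the minimum is 1-Lipschitz.\<close>
  define B where "B = (\<Sum>z\<in>Z. \<bar>q z\<bar>)"
  define d where "d n x = (xi2 Z f (\<lambda>z. p z + e n * q z) x - xi2 Z f p x) / e n" for n x
  have "(\<lambda>n. \<integral>x. d n x \<partial>M) \<longlonglongrightarrow> (\<integral>x. (MIN z\<in>argmin p x. q z) \<partial>M)"
  proof (rule integral_dominated_convergence)
    show "(\<lambda>x. MIN z\<in>argmin p x. q z) \<in> borel_measurable M"
      using has_bochner_integral_argmin[of "\<lambda>S. MIN z\<in>S. q z" p]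
      by (auto simp: has_bochner_integral_iff)
    show "d n \<in> borel_measurable M" for n unfolding d_def by measurable
    show "integrable M (\<lambda>_. B)" by simp
    show "AE x in M. (\<lambda>n. d n x) \<longlonglongrightarrow> (MIN z\<in>argmin p x. q z)"
    proof (rule AE_I2)
      fix x
      have "\<forall>\<^sub>F n in sequentially. xi2 Z f (\<lambda>z. p z + e n * q z) x
          = xi2 Z f p x + e n * (MIN z\<in>argmin p x. q z)"
        using eventually_compose_filterlim[OF eventually_Min_image_perturbation[OF finite_Z nonempty_Z] e,
          of "\<lambda>z. f z x + p z" q]
        by (simp add: xi2_def argmin_def add.assoc)
      then have "\<forall>\<^sub>F n in sequentially. d n x = (MIN z\<in>argmin p x. q z)"
        by (rule eventually_mono) (use e_pos in \<open>simp add: d_def less_imp_neq[symmetric]\<close>)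
      then show "(\<lambda>n. d n x) \<longlonglongrightarrow> (MIN z\<in>argmin p x. q z)" by (rule tendsto_eventually)
    qed
    show "AE x in M. norm (d n x) \<le> B" for n
    proof (rule AE_I2)
      fix x
      have "\<bar>xi2 Z f (\<lambda>z. p z + e n * q z) x - xi2 Z f p x\<bar> \<le> e n * B"
      proof (rule abs_xi2_diff_le)
        fix z assume "z \<in> Z"
        then have "\<bar>q z\<bar> \<le> B" unfolding B_def using finite_Z by (intro member_le_sum) auto
        then show "\<bar>(p z + e n * q z) - p z\<bar> \<le> e n * B" using e_pos[of n] by (simp add: abs_mult)
      qed
      then show "norm (d n x) \<le> B" using e_pos[of n] by (simp add: d_def field_simps)
    qed
  qed
  moreover have "(\<integral>x. d n x \<partial>M) = (Xi2 Z f M (\<lambda>z. p z + e n * q z) - Xi2 Z f M p) / e n" for n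
    unfolding d_def Xi2_def
    by (subst integral_divide_zero, subst Bochner_Integration.integral_diff[OF integrable_xi2 integrable_xi2]) (rule refl)
  moreover have "(\<integral>x. (MIN z\<in>argmin p x. q z) \<partial>M) = (\<Sum>S\<in>Pow Z - {{}}. argmin_weight p S * (MIN z\<in>S. q z))"
    by (rule has_bochner_integral_integral_eq[OF has_bochner_integral_argmin])
  ultimately show ?thesis by (simp only: e_def)
qed

end

section \<open>Duality\<close>

text \<open>The unit mass at \<open>x\<close> is split among the minimisers at \<open>x\<close> by
  \<open>g z x = t (argmin p x, z)\<close>; integration turns this split into an allocation.\<close>

lemma (in finite_cost) exists_weights_of_selection:
  assumes "t \<in> selections Z"
  obtains g where "\<And>z. integrable M (g z)" "\<And>z x. 0 \<le> g z x"
    "\<And>x. x \<in> space M \<Longrightarrow> (\<Sum>z\<in>Z. g z x) = 1"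
    "\<And>z. (\<integral>x. g z x \<partial>M) = allocation Z (argmin_weight p) t z"
    "\<And>z x. 0 < g z x \<Longrightarrow> z \<in> argmin p x"
proof -
  define g where "g z x = t (argmin p x, z)" for z x
  have t: "\<And>i. 0 \<le> t i" "\<And>S z. z \<notin> S \<Longrightarrow> t (S, z) = 0"
    "\<And>S. S \<subseteq> Z \<Longrightarrow> S \<noteq> {} \<Longrightarrow> (\<Sum>z\<in>Z. t (S, z)) = 1"
    using assms unfolding selections_iff by blast+
  show ?thesis
  proof (rule that[of g])
    show "integrable M (g z)" "(\<integral>x. g z x \<partial>M) = allocation Z (argmin_weight p) t z" for z
      using has_bochner_integral_argmin[of "\<lambda>S. t (S, z)" p]
      unfolding g_def allocation_def has_bochner_integral_iff by auto
    show "0 \<le> g z x" for z x using t(1) by (simp add: g_def)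
    show "(\<Sum>z\<in>Z. g z x) = 1" for x
      unfolding g_def using argmin_subset argmin_nonempty by (rule t(3))
    show "z \<in> argmin p x" if "0 < g z x" for z x
      using t(2)[of z "argmin p x"] that unfolding g_def by fastforce
  qed
qed

section \<open>The dual functional: existence of a maximiser and first-order condition\<close>

locale finite_cost_pair = M: finite_cost M Z f + N: finite_cost N Z g
  for M :: "'a measure" and N :: "'b measure" and Z :: "'z set"
    and f :: "'z \<Rightarrow> 'a \<Rightarrow> real" and g :: "'z \<Rightarrow> 'b \<Rightarrow> real"
begin

text \<open>This is \<open>Xi\<close> with \<open>p\<close> negated everywhere instead of on
  \<open>Z\<close> only; values off \<open>Z\<close> have no influence on the minima.\<close>

definition dual :: "('z \<Rightarrow> real) \<Rightarrow> real" where
  "dual p = Xi2 Z f M p + Xi2 Z g N (\<lambda>z. - p z)"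

lemma continuous_on_dual: "continuous_on UNIV dual"
proof -
  have "continuous_on UNIV (\<lambda>p :: 'z \<Rightarrow> real. \<lambda>z. - p z)"
    by (intro continuous_on_coordinatewise_then_product continuous_on_minus
        continuous_on_product_coordinates)
  then show ?thesis unfolding dual_def
    by (intro continuous_on_add M.continuous_on_Xi2 continuous_on_compose2[OF N.continuous_on_Xi2]) auto
qed

lemma dual_cong: "(\<And>z. z \<in> Z \<Longrightarrow> p z = q z) \<Longrightarrow> dual p = dual q"
  unfolding dual_def by (intro arg_cong2[where f = "(+)"] Xi2_cong) auto

lemma dual_add_const: "dual (\<lambda>z. p z + a) = dual p"
  using M.Xi2_add_const[of p a] N.Xi2_add_const[of "\<lambda>z. - p z" "- a"] by (simp add: dual_def)

text \<open>Since \<open>dual\<close> is invariant under adding constants, the potential may be normalised to vanish at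
  one point of \<open>Z\<close>; on normalised potentials \<open>dual\<close> is coercive.\<close>
lemma exists_dual_maximizer: "\<exists>p. \<forall>q. dual q \<le> dual p"
proof -
  obtain z0 where z0: "z0 \<in> Z" using M.nonempty_Z by blast
  define C where "C = (\<Sum>z\<in>Z. \<bar>\<integral>x. f z x \<partial>M\<bar>) + (\<Sum>z\<in>Z. \<bar>\<integral>y. g z y \<partial>N\<bar>)"
  have C: "(\<integral>x. f z x \<partial>M) + (\<integral>y. g z' y \<partial>N) \<le> C" if "z \<in> Z" "z' \<in> Z" for z z'
    using member_le_sum[of z Z "\<lambda>z. \<bar>\<integral>x. f z x \<partial>M\<bar>"]
      member_le_sum[of z' Z "\<lambda>z. \<bar>\<integral>y. g z y \<partial>N\<bar>"] that M.finite_Z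
    unfolding C_def by auto
  \<comment> \<open>If \<open>q z \<ge> 0\<close>, the first term is bounded at \<open>z0\<close>
    and the second at \<open>z\<close>; if \<open>q z < 0\<close>, the other way round.\<close>
  have coercive: "dual q \<le> C - \<bar>q z\<bar>" if "z \<in> Z" "q z0 = 0" for q z
    using M.Xi2_le[OF that(1), of q] M.Xi2_le[OF z0, of q] C[OF that(1) z0] C[OF z0 that(1)]
      N.Xi2_le[OF that(1), of "\<lambda>z. - q z"] N.Xi2_le[OF z0, of "\<lambda>z. - q z"] that(2)
    unfolding dual_def by (cases "0 \<le> q z") auto
  \<comment> \<open>Once some \<open>\<bar>q z\<bar>\<close> exceeds \<open>R\<close>, the bound
    \<open>C - \<bar>q z\<bar>\<close> lies below the value of \<open>dual\<close> at 0.\<close>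
  define R where "R = \<bar>C - dual (\<lambda>_. 0)\<bar>"
  define K where "K = (UNIV \<rightarrow>\<^sub>E {-R..R} :: ('z \<Rightarrow> real) set)"
  have "compact K"
    using compactin_PiE[of "\<lambda>_. euclidean" UNIV "\<lambda>_. {-R..R}"]
    by (simp add: K_def euclidean_product_topology)
  moreover have K0: "(\<lambda>_. 0) \<in> K" by (simp add: K_def R_def PiE_UNIV_domain)
  moreover have "continuous_on K dual"
    using continuous_on_dual continuous_on_subset by blast
  ultimately obtain p where p: "p \<in> K" "\<And>q. q \<in> K \<Longrightarrow> dual q \<le> dual p"
    using continuous_attains_sup[of K dual] by blast
  have "dual q \<le> dual p" for q
  proof -
    \<comment> \<open>Subtracting \<open>q z0\<close> normalises the potential; the value 0 off
      \<open>Z\<close> lets it lie in the box \<open>K\<close>, whose coordinates run over the whole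
      type. Neither change affects \<open>dual\<close>.\<close>
    define u where "u z = (if z \<in> Z then q z - q z0 else 0)" for z
    have "dual u = dual (\<lambda>z. q z + - q z0)" by (rule dual_cong) (simp add: u_def)
    then have q: "dual q = dual u" by (simp only: dual_add_const)
    show ?thesis
    proof (cases "\<forall>z\<in>Z. \<bar>u z\<bar> \<le> R")
      case True
      then have "\<bar>u z\<bar> \<le> R" for z by (cases "z \<in> Z") (auto simp: u_def R_def)
      then have "- R \<le> u z \<and> u z \<le> R" for z by (simp add: abs_le_iff minus_le_iff)
      then have "u \<in> K" by (simp add: K_def PiE_UNIV_domain)
      then show ?thesis using p q by simp
    next
      case False
      then obtain z where z: "z \<in> Z" "R < \<bar>u z\<bar>" by auto
      have "dual u \<le> C - \<bar>u z\<bar>" using z by (intro coercive) (simp_all add: u_def z0)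
      also have "\<dots> \<le> dual (\<lambda>_. 0)" using z(2) unfolding R_def by linarith
      also have "\<dots> \<le> dual p" by (rule p(2)[OF K0])
      finally show ?thesis using q by simp
    qed
  qed
  then show ?thesis by blast
qed

text \<open>The left-hand side is the one-sided derivative of \<open>dual\<close> at
  \<open>p\<close> along \<open>q\<close>: the second term moves from \<open>- p\<close> in
  direction \<open>- q\<close>. At a maximiser all difference quotients are at most 0.\<close>

lemma directional_derivative_nonpos_at_maximizer:
  assumes "\<And>q. dual q \<le> dual p"
  shows "(\<Sum>S\<in>Pow Z - {{}}. M.argmin_weight p S * (MIN z\<in>S. q z))
    + (\<Sum>S\<in>Pow Z - {{}}. N.argmin_weight (\<lambda>z. - p z) S * (MIN z\<in>S. - q z)) \<le> 0"
proof -
  define e :: "nat \<Rightarrow> real" where "e n = inverse (real (Suc n))" for n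
  have "(dual (\<lambda>z. p z + e n * q z) - dual p) / e n
      = (Xi2 Z f M (\<lambda>z. p z + e n * q z) - Xi2 Z f M p) / e n
      + (Xi2 Z g N (\<lambda>z. - p z + e n * - q z) - Xi2 Z g N (\<lambda>z. - p z)) / e n" for n
  proof -
    have "(\<lambda>z. - (p z + e n * q z)) = (\<lambda>z. - p z + e n * - q z)" by auto
    then show ?thesis unfolding dual_def by (simp only: add_divide_distrib[symmetric]) argo
  qed
  then have "(\<lambda>n. (dual (\<lambda>z. p z + e n * q z) - dual p) / e n) \<longlonglongrightarrow>
    (\<Sum>S\<in>Pow Z - {{}}. M.argmin_weight p S * (MIN z\<in>S. q z))
    + (\<Sum>S\<in>Pow Z - {{}}. N.argmin_weight (\<lambda>z. - p z) S * (MIN z\<in>S. - q z))"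
    unfolding e_def by (simp only:) (intro tendsto_add M.Xi2_directional_derivative N.Xi2_directional_derivative)
  moreover have "(dual (\<lambda>z. p z + e n * q z) - dual p) / e n \<le> 0" for n
    using assms[of "\<lambda>z. p z + e n * q z"] by (simp add: e_def divide_nonpos_pos)
  ultimately show ?thesis by (intro LIMSEQ_le_const2) auto
qed

text \<open>A separating \<open>q\<close> would be a direction of ascent, so both sides admit equal
  allocations. The resulting weights give each \<open>z\<close> the same mass, charge only
  minimisers, and can be glued.\<close>

lemma exists_complementary_coupling:
  assumes "\<And>q. dual q \<le> dual p"
  obtains \<pi> where "prob_space \<pi>" "sets \<pi> = sets (M \<Otimes>\<^sub>M N)"
    "distr \<pi> M fst = M" "distr \<pi> N snd = N"
    "AE w in \<pi>. \<exists>z\<in>Z. z \<in> M.argmin p (fst w) \<and> z \<in> N.argmin (\<lambda>z. - p z) (snd w)"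
proof -
  obtain t s where ts: "t \<in> selections Z" "s \<in> selections Z"
    and eq: "\<And>z. z \<in> Z \<Longrightarrow> allocation Z (M.argmin_weight p) t z
      = allocation Z (N.argmin_weight (\<lambda>z. - p z)) s z"
  proof (rule equal_allocations_or_separation[OF M.finite_Z,
        of "M.argmin_weight p" "N.argmin_weight (\<lambda>z. - p z)"])
    fix q assume "0 < (\<Sum>S\<in>Pow Z - {{}}. M.argmin_weight p S * (MIN z\<in>S. q z))
      + (\<Sum>S\<in>Pow Z - {{}}. N.argmin_weight (\<lambda>z. - p z) S * (MIN z\<in>S. - q z))"
    with directional_derivative_nonpos_at_maximizer[OF assms, of q] show thesis by linarith
  qed (use that in blast)
  obtain h where h: "\<And>z. integrable M (h z)" "\<And>z x. 0 \<le> h z x"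
    "\<And>x. x \<in> space M \<Longrightarrow> (\<Sum>z\<in>Z. h z x) = 1"
    "\<And>z. (\<integral>x. h z x \<partial>M) = allocation Z (M.argmin_weight p) t z"
    "\<And>z x. 0 < h z x \<Longrightarrow> z \<in> M.argmin p x"
    by (rule M.exists_weights_of_selection[OF ts(1), of p]) (rule that)
  obtain k where k: "\<And>z. integrable N (k z)" "\<And>z x. 0 \<le> k z x"
    "\<And>x. x \<in> space N \<Longrightarrow> (\<Sum>z\<in>Z. k z x) = 1"
    "\<And>z. (\<integral>x. k z x \<partial>N) = allocation Z (N.argmin_weight (\<lambda>z. - p z)) s z"
    "\<And>z x. 0 < k z x \<Longrightarrow> z \<in> N.argmin (\<lambda>z. - p z) x"
    by (rule N.exists_weights_of_selection[OF ts(2), of "\<lambda>z. - p z"]) (rule that)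
  have masses: "(\<integral>x. h z x \<partial>M) = (\<integral>y. k z y \<partial>N)" if "z \<in> Z" for z
    using eq[OF that] by (simp add: h(4) k(4))
  obtain \<pi> where \<pi>: "prob_space \<pi>" "sets \<pi> = sets (M \<Otimes>\<^sub>M N)"
    "distr \<pi> M fst = M" "distr \<pi> N snd = N"
    "AE w in \<pi>. \<exists>z\<in>Z. 0 < h z (fst w) \<and> 0 < k z (snd w)"
    by (rule exists_glued_coupling[OF M.prob_space_axioms N.prob_space_axioms M.finite_Z
          h(1,2) k(1,2) h(3) k(3) masses]) (assumption | rule that)+
  show ?thesis
  proof (rule that[OF \<pi>(1-4)])
    show "AE w in \<pi>. \<exists>z\<in>Z. z \<in> M.argmin p (fst w) \<and> z \<in> N.argmin (\<lambda>z. - p z) (snd w)"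
      using \<pi>(5) by (rule AE_mp) (use h(5) k(5) in blast)
  qed
qed

section \<open>Weak and strong duality\<close>

lemma has_bochner_integral_sum_xi2:
  assumes "sets \<pi> = sets (M \<Otimes>\<^sub>M N)" "distr \<pi> M fst = M" "distr \<pi> N snd = N"
  shows "has_bochner_integral \<pi>
    (\<lambda>w. xi2 Z f p (fst w) + xi2 Z g (\<lambda>z. - p z) (snd w)) (dual p)"
proof -
  have [measurable]: "fst \<in> measurable \<pi> M" "snd \<in> measurable \<pi> N"
    using assms(1) by (simp_all cong: measurable_cong_sets)
  have "has_bochner_integral \<pi> (\<lambda>w. xi2 Z f p (fst w)) (Xi2 Z f M p)"
    using M.integrable_xi2[of p] integrable_distr_eq[of fst \<pi> M "xi2 Z f p"]
      integral_distr[of fst \<pi> M "xi2 Z f p"] assms(2)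
    by (simp add: has_bochner_integral_iff Xi2_def)
  moreover have "has_bochner_integral \<pi> (\<lambda>w. xi2 Z g (\<lambda>z. - p z) (snd w)) (Xi2 Z g N (\<lambda>z. - p z))"
    using N.integrable_xi2[of "\<lambda>z. - p z"] integrable_distr_eq[of snd \<pi> N "xi2 Z g (\<lambda>z. - p z)"]
      integral_distr[of snd \<pi> N "xi2 Z g (\<lambda>z. - p z)"] assms(3)
    by (simp add: has_bochner_integral_iff Xi2_def)
  ultimately show ?thesis unfolding dual_def by (rule has_bochner_integral_add)
qed

text \<open>Adding the bounds of both sides at the same \<open>z\<close> cancels \<open>p z\<close>.
  The two estimates meet when \<open>z\<close> is a minimiser on both sides.\<close>

lemma semidiscrete_cost_bounds:
  shows "xi2 Z f p x + xi2 Z g (\<lambda>z. - p z) y \<le> semidiscrete_cost Z (\<lambda>x z. f z x) g (x, y)"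
    and "z \<in> Z \<Longrightarrow> semidiscrete_cost Z (\<lambda>x z. f z x) g (x, y) \<le> f z x + g z y"
proof -
  have "xi2 Z f p x + xi2 Z g (\<lambda>z. - p z) y \<le> f z x + g z y" if "z \<in> Z" for z
    using M.xi2_le[OF that, of p x] N.xi2_le[OF that, of "\<lambda>z. - p z" y] by simp
  then show "xi2 Z f p x + xi2 Z g (\<lambda>z. - p z) y \<le> semidiscrete_cost Z (\<lambda>x z. f z x) g (x, y)"
    using M.finite_Z M.nonempty_Z by (simp add: semidiscrete_cost_def)
  show "z \<in> Z \<Longrightarrow> semidiscrete_cost Z (\<lambda>x z. f z x) g (x, y) \<le> f z x + g z y"
    using M.finite_Z by (simp add: semidiscrete_cost_def)
qed

text \<open>The cost lies between the two minima for the potential 0 and the cost through one fixed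
  \<open>z\<close>. Both are sums of functions of one coordinate, integrable because the marginals
  are prescribed.\<close>

lemma integrable_semidiscrete_cost:
  assumes "sets \<pi> = sets (M \<Otimes>\<^sub>M N)" "distr \<pi> M fst = M" "distr \<pi> N snd = N"
  shows "integrable \<pi> (semidiscrete_cost Z (\<lambda>x z. f z x) g)"
proof -
  obtain z where z: "z \<in> Z" using M.nonempty_Z by blast
  have [measurable]: "fst \<in> measurable \<pi> M" "snd \<in> measurable \<pi> N"
    using assms(1) by (simp_all cong: measurable_cong_sets)
  have fg: "integrable \<pi> (\<lambda>w. f z (fst w) + g z (snd w))"
    using M.integrable_cost[OF z] N.integrable_cost[OF z] z
      integrable_distr_eq[of fst \<pi> M "f z"] integrable_distr_eq[of snd \<pi> N "g z"] assms(2,3)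
    by (intro Bochner_Integration.integrable_add) auto
  have xi: "integrable \<pi> (\<lambda>w. xi2 Z f (\<lambda>_. 0) (fst w) + xi2 Z g (\<lambda>z. - 0) (snd w))"
    using has_bochner_integral_sum_xi2[OF assms, of "\<lambda>_. 0"] unfolding has_bochner_integral_iff by (rule conjunct1)
  show ?thesis
  proof (rule Bochner_Integration.integrable_bound)
    show "integrable \<pi> (\<lambda>w. \<bar>f z (fst w) + g z (snd w)\<bar>
        + \<bar>xi2 Z f (\<lambda>_. 0) (fst w) + xi2 Z g (\<lambda>z. - 0) (snd w)\<bar>)"
      by (rule Bochner_Integration.integrable_add[OF integrable_abs[OF fg] integrable_abs[OF xi]])
    show "semidiscrete_cost Z (\<lambda>x z. f z x) g \<in> borel_measurable \<pi>"
      unfolding semidiscrete_cost_def case_prod_beta using M.finite_Z by measurable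
    have "\<bar>semidiscrete_cost Z (\<lambda>x z. f z x) g w\<bar> \<le> \<bar>f z (fst w) + g z (snd w)\<bar>
        + \<bar>xi2 Z f (\<lambda>_. 0) (fst w) + xi2 Z g (\<lambda>z. - 0) (snd w)\<bar>" for w
      using semidiscrete_cost_bounds(1)[of "\<lambda>_. 0" "fst w" "snd w"]
        semidiscrete_cost_bounds(2)[OF z, of "fst w" "snd w"] by simp
    then show "AE w in \<pi>. norm (semidiscrete_cost Z (\<lambda>x z. f z x) g w)
      \<le> norm (\<bar>f z (fst w) + g z (snd w)\<bar>
        + \<bar>xi2 Z f (\<lambda>_. 0) (fst w) + xi2 Z g (\<lambda>z. - 0) (snd w)\<bar>)" by simp
  qed
qed

lemma weak_duality:
  assumes "sets \<pi> = sets (M \<Otimes>\<^sub>M N)" "distr \<pi> M fst = M" "distr \<pi> N snd = N"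
  shows "dual p \<le> (\<integral>w. semidiscrete_cost Z (\<lambda>x z. f z x) g w \<partial>\<pi>)"
proof -
  have "dual p = (\<integral>w. xi2 Z f p (fst w) + xi2 Z g (\<lambda>z. - p z) (snd w) \<partial>\<pi>)"
    using has_bochner_integral_sum_xi2[OF assms] by (simp add: has_bochner_integral_iff)
  also have "\<dots> \<le> (\<integral>w. semidiscrete_cost Z (\<lambda>x z. f z x) g w \<partial>\<pi>)"
    using has_bochner_integral_sum_xi2[OF assms] semidiscrete_cost_bounds(1)
    by (intro integral_mono integrable_semidiscrete_cost assms) (auto simp: has_bochner_integral_iff)
  finally show ?thesis .
qed

lemma strong_duality:
  obtains p \<pi> where "sets \<pi> = sets (M \<Otimes>\<^sub>M N)" "prob_space \<pi>"
    "distr \<pi> M fst = M" "distr \<pi> N snd = N"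
    "(\<integral>w. semidiscrete_cost Z (\<lambda>x z. f z x) g w \<partial>\<pi>) = dual p"
proof -
  obtain p where p: "\<And>q. dual q \<le> dual p" using exists_dual_maximizer by blast
  obtain \<pi> where \<pi>: "prob_space \<pi>" "sets \<pi> = sets (M \<Otimes>\<^sub>M N)"
    "distr \<pi> M fst = M" "distr \<pi> N snd = N"
    and compl: "AE w in \<pi>. \<exists>z\<in>Z. z \<in> M.argmin p (fst w) \<and> z \<in> N.argmin (\<lambda>z. - p z) (snd w)"
    by (rule exists_complementary_coupling[OF p]) (rule that)
  have "AE w in \<pi>. semidiscrete_cost Z (\<lambda>x z. f z x) g w
      = xi2 Z f p (fst w) + xi2 Z g (\<lambda>z. - p z) (snd w)"
  proof (rule AE_mp[OF compl], intro AE_I2 impI)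
    fix w assume "\<exists>z\<in>Z. z \<in> M.argmin p (fst w) \<and> z \<in> N.argmin (\<lambda>z. - p z) (snd w)"
    then obtain z where z: "z \<in> Z" "z \<in> M.argmin p (fst w)" "z \<in> N.argmin (\<lambda>z. - p z) (snd w)"
      by blast
    show "semidiscrete_cost Z (\<lambda>x z. f z x) g w
      = xi2 Z f p (fst w) + xi2 Z g (\<lambda>z. - p z) (snd w)"
      \<comment> \<open>At the common minimiser \<open>z\<close> the terms \<open>p z\<close> and
        \<open>- p z\<close> cancel, so the lower and the upper bound for the cost coincide.\<close>
      using semidiscrete_cost_bounds(1)[of p "fst w" "snd w"]
        semidiscrete_cost_bounds(2)[OF z(1), of "fst w" "snd w"]
        M.xi2_eq_of_mem_argmin[OF z(2)] N.xi2_eq_of_mem_argmin[OF z(3)] by simp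
  qed
  moreover have "integrable \<pi> (semidiscrete_cost Z (\<lambda>x z. f z x) g)"
    by (rule integrable_semidiscrete_cost[OF \<pi>(2-4)])
  ultimately have "(\<integral>w. semidiscrete_cost Z (\<lambda>x z. f z x) g w \<partial>\<pi>)
      = (\<integral>w. xi2 Z f p (fst w) + xi2 Z g (\<lambda>z. - p z) (snd w) \<partial>\<pi>)"
    using has_bochner_integral_sum_xi2[OF \<pi>(2-4), of p]
    by (intro integral_cong_AE) (auto simp: has_bochner_integral_iff)
  also have "\<dots> = dual p"
    using has_bochner_integral_sum_xi2[OF \<pi>(2-4), of p] by (simp add: has_bochner_integral_iff)
  finally show ?thesis using \<pi> that by blast
qed

end

text \<open>The existence of an optimal coupling makes the real infimum a genuine minimum, and
  boundedness makes the real supremum meaningful. The set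
  \<open>Z \<rightarrow>\<^sub>E UNIV\<close> models the vectors indexed by \<open>Z\<close>, with a
  fixed value off \<open>Z\<close>.\<close>

theorem theorem2p1:
  fixes \<mu> :: "'a::polish_space measure" and \<nu> :: "'b::polish_space measure"
    and Z :: "'z set"
    and c1 :: "'a \<Rightarrow> 'z \<Rightarrow> real" and c2 :: "'z \<Rightarrow> 'b \<Rightarrow> real"
  assumes "prob_space \<mu>" and "sets \<mu> = sets borel"
    and "prob_space \<nu>" and "sets \<nu> = sets borel"
    and "finite Z" and "Z \<noteq> {}"
    and "\<And>z. z \<in> Z \<Longrightarrow> (\<lambda>x. c1 x z) \<in> borel_measurable borel"
    and "\<And>z. z \<in> Z \<Longrightarrow> integrable \<mu> (\<lambda>x. c1 x z)"
    and "\<And>z. z \<in> Z \<Longrightarrow> (\<lambda>y. c2 z y) \<in> borel_measurable borel"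
    and "\<And>z. z \<in> Z \<Longrightarrow> integrable \<nu> (\<lambda>y. c2 z y)"
  shows "(\<exists>\<pi>. is_optimal_coupling (semidiscrete_cost Z c1 c2) \<mu> \<nu> \<pi>)
    \<and> bdd_above (Xi Z c1 c2 \<mu> \<nu> ` (Z \<rightarrow>\<^sub>E UNIV))
    \<and> (SUP p\<in>(Z \<rightarrow>\<^sub>E UNIV). Xi Z c1 c2 \<mu> \<nu> p) = transport_value (semidiscrete_cost Z c1 c2) \<mu> \<nu>"
proof -
  interpret \<mu>: prob_space \<mu> by fact
  interpret \<nu>: prob_space \<nu> by fact
  interpret finite_cost_pair \<mu> \<nu> Z "\<lambda>z x. c1 x z" c2
    using assms by unfold_locales auto
  define I where "I = (\<lambda>\<pi>. \<integral>w. semidiscrete_cost Z c1 c2 w \<partial>\<pi>)"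
  have Xi: "Xi Z c1 c2 \<mu> \<nu> p = dual p" for p
    unfolding Xi_def dual_def Xi1_eq_Xi2 by (intro arg_cong2[where f = "(+)"] refl Xi2_cong) simp
  \<comment> \<open>For second countable spaces the Borel sets of the product are those of the
    product sigma-algebra.\<close>
  have sets: "sets (\<mu> \<Otimes>\<^sub>M \<nu>) = sets (borel :: ('a \<times> 'b) measure)"
    using assms by (simp add: borel_prod[symmetric] cong: sets_pair_measure_cong)
  have coupling_iff: "\<pi> \<in> couplings \<mu> \<nu> \<longleftrightarrow> prob_space \<pi> \<and> sets \<pi> = sets (\<mu> \<Otimes>\<^sub>M \<nu>)
      \<and> distr \<pi> \<mu> fst = \<mu> \<and> distr \<pi> \<nu> snd = \<nu>" for \<pi>
  proof -
    have "distr \<pi> \<mu> fst = distr \<pi> borel fst" "distr \<pi> \<nu> snd = distr \<pi> borel snd"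
      using assms by (auto intro: distr_cong)
    then show ?thesis by (simp add: couplings_def sets)
  qed
  obtain p \<pi> where \<pi>: "\<pi> \<in> couplings \<mu> \<nu>" and eq: "I \<pi> = dual p"
    using strong_duality unfolding coupling_iff I_def by metis
  have weak: "dual q \<le> I \<rho>" if "\<rho> \<in> couplings \<mu> \<nu>" for q \<rho>
    using that weak_duality unfolding coupling_iff I_def by blast
  have "is_optimal_coupling (semidiscrete_cost Z c1 c2) \<mu> \<nu> \<pi>"
    unfolding is_optimal_coupling_def is_arg_min_linorder using \<pi> weak[of _ p] eq by (simp add: I_def)
  moreover have "bdd_above (Xi Z c1 c2 \<mu> \<nu> ` (Z \<rightarrow>\<^sub>E UNIV))"
    using weak[OF \<pi>] by (auto simp: Xi intro!: bdd_aboveI2)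
  moreover have "(SUP p\<in>(Z \<rightarrow>\<^sub>E UNIV). Xi Z c1 c2 \<mu> \<nu> p) = I \<pi>"
  proof (rule cSup_eq_maximum)
    \<comment> \<open>The maximiser is a function on the whole type; restricting it to
      \<open>Z\<close> puts it into the index set and keeps its value.\<close>
    have "dual (restrict p Z) = I \<pi>" unfolding eq by (rule dual_cong) simp
    then show "I \<pi> \<in> Xi Z c1 c2 \<mu> \<nu> ` (Z \<rightarrow>\<^sub>E UNIV)"
      using Xi by (intro image_eqI[of _ _ "restrict p Z"]) auto
    show "\<And>x. x \<in> Xi Z c1 c2 \<mu> \<nu> ` (Z \<rightarrow>\<^sub>E UNIV) \<Longrightarrow> x \<le> I \<pi>" using weak[OF \<pi>] Xi by auto
  qed
  moreover have "transport_value (semidiscrete_cost Z c1 c2) \<mu> \<nu> = I \<pi>"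
    unfolding transport_value_def I_def[symmetric]
    using weak[of _ p] eq by (intro cInf_eq_minimum imageI \<pi>) auto
  ultimately show ?thesis by auto
qed

end
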